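(* Let $N\ge1$ and consider the weighted spider network $G$ with $N$ legs and parameters $\gamma=(\gamma_1,\gamma_2^{(1)},\dots,\gamma_2^{(N)},\gamma_3)\in\mathbb R_+\times(\mathbb R_+^* )^{N+1}$. Put $\mathcal S_2=\gamma_2^{(1)}+\cdots+\gamma_2^{(N)}$ and assume $\Lambda=2\gamma_3-\gamma_1-\mathcal S_2<0$. Let $\rho$ be the combinatorial spectral radius of $G$. Then there exists a unique MERW on $G$. The positive right eigenfunction associated with $\rho$ (unique up to a multiplicative constant) is $\psi((n,k))=\Gamma^n$ for all $n\ge0$ and $1\le k\le N$, where $$\Gamma=\frac{\rho-\gamma_1}{\mathcal S_2}.$$ For all $1\le k\le N$ and $n\ge1$ the transition probabilities are $$P((n,k),(n\pm1,k))=\frac{\gamma_3}{\rho}\Gamma^{\pm1},\qquad P(\mathbf 0,(1,k))=\frac{\gamma_2^{(k)}\Gamma}{\rho},\qquad P(\mathbf 0,\mathbf 0)=\frac{\gamma_1}{\rho}.$$ Moreover the MERW is positive recurrent, and its invariant probability measure is, for $n\ge1$ and $1\le k\le N$, $$\pi((n,k))=\frac{\gamma_2^{(k)}(1-\Gamma^2)\Gamma^{2n}}{\mathcal S_2\Gamma^2+\gamma_3(1-\Gamma^2)},\qquad \pi(\mathbf 0)=\frac{\gamma_3(1-\Gamma^2)}{\mathcal S_2\Gamma^2+\gamma_3(1-\Gamma^2)}.$$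
   Context: The weighted spider network has vertex set $G=\{(n,k):n\in\mathbb N_0,\ 1\le k\le N\}$ with the identification $\mathbf 0=(0,1)=\cdots=(0,N)$. Its weighted adjacency matrix $A$ is given, for $n\ge1$ and $1\le k\le N$, by $A(\mathbf 0,\mathbf 0)=\gamma_1$, $A(\mathbf 0,(1,k))=\gamma_2^{(k)}$, $A((n,k),(n\pm1,k))=\gamma_3$, and $A=0$ otherwise. Here $\mathbb R_+=[0,\infty)$ and $\mathbb R_+^*=(0,\infty)$. The combinatorial spectral radius $\rho$ is the inverse of the radius of convergence of $\sum_{n\ge0}A^n(x,y)z^n$, which does not depend on $x,y\in G$. When $\Lambda<0$ it equals $$\rho=\frac{2\gamma_3(\gamma_1^2+\mathcal S_2^2)}{\gamma_1(2\gamma_3-\mathcal S_2)+\mathcal S_2\sqrt{\gamma_1^2+4\gamma_3(\mathcal S_2-\gamma_3)}}.$$ A MERW (maximal entropy random walk) on $G$ is a Markov chain with kernel $P(x,y)=A(x,y)\frac{\psi(y)}{\rho\,\psi(x)}$, where $\psi:G\to(0,\infty)$ satisfies $A\psi=\rho\psi$. Uniqueness of the MERW means uniqueness of the kernel $P$. *)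

theory Defs
  imports "HOL-Analysis.Analysis"
begin

section \<open>Nonnegative matrices and Markov kernels on a set of states\<close>

text \<open>Matrices are functions \<open>A :: 'v \<Rightarrow> 'v \<Rightarrow> real\<close>; only their entries on the state
  set \<open>G\<close> matter.\<close>

primrec mat_pow :: "'v set \<Rightarrow> ('v \<Rightarrow> 'v \<Rightarrow> real) \<Rightarrow> nat \<Rightarrow> 'v \<Rightarrow> 'v \<Rightarrow> real" where
  "mat_pow G A 0 x y = (if x = y then 1 else 0)"
| "mat_pow G A (Suc n) x y = (\<Sum>\<^sub>\<infinity>z\<in>G. A x z * mat_pow G A n z y)"

text \<open>For irreducible \<open>A\<close> the value does not depend on the base points \<open>x\<close>, \<open>y\<close>. They are
  kept as arguments, so that results can be stated for an arbitrary choice of them.\<close>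

definition comb_spectral_radius :: "'v set \<Rightarrow> ('v \<Rightarrow> 'v \<Rightarrow> real) \<Rightarrow> 'v \<Rightarrow> 'v \<Rightarrow> real" where
  "comb_spectral_radius G A x y =
     real_of_ereal (inverse (conv_radius (\<lambda>n. mat_pow G A n x y)))"

definition positive_eigenfunction ::
    "'v set \<Rightarrow> ('v \<Rightarrow> 'v \<Rightarrow> real) \<Rightarrow> real \<Rightarrow> ('v \<Rightarrow> real) \<Rightarrow> bool" where
  "positive_eigenfunction G A r \<psi> \<longleftrightarrow>
     (\<forall>x\<in>G. \<psi> x > 0) \<and> (\<forall>x\<in>G. ((\<lambda>y. A x y * \<psi> y) has_sum (r * \<psi> x)) G)"

definition markov_kernel :: "'v set \<Rightarrow> ('v \<Rightarrow> 'v \<Rightarrow> real) \<Rightarrow> bool" where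
  "markov_kernel G P \<longleftrightarrow> (\<forall>x\<in>G. (\<forall>y\<in>G. 0 \<le> P x y) \<and> (P x has_sum 1) G)"

text \<open>In the following definition \<open>r\<close> is meant to be the combinatorial spectral radius of \<open>A\<close>.\<close>

definition is_MERW :: "'v set \<Rightarrow> ('v \<Rightarrow> 'v \<Rightarrow> real) \<Rightarrow> real \<Rightarrow> ('v \<Rightarrow> 'v \<Rightarrow> real) \<Rightarrow> bool" where
  "is_MERW G A r P \<longleftrightarrow> markov_kernel G P \<and>
     (\<exists>\<psi>. positive_eigenfunction G A r \<psi> \<and>
          (\<forall>x\<in>G. \<forall>y\<in>G. P x y = A x y * (\<psi> y / (r * \<psi> x))))"

fun path_prob :: "('v \<Rightarrow> 'v \<Rightarrow> real) \<Rightarrow> 'v list \<Rightarrow> real" where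
  "path_prob P (x # y # w) = P x y * path_prob P (y # w)"
| "path_prob P _ = 1"

text \<open>The probability that the chain started at \<open>x\<close> has first return time
  \<open>T = inf {n \<ge> 1. X\<^sub>n = x}\<close> equal to \<open>n\<close>, as the total probability of all trajectories
  \<open>x, w\<^sub>1, \<dots>, w\<^sub>n\<^sub>-\<^sub>1, x\<close> whose intermediate states differ from \<open>x\<close> (it is \<open>0\<close> for \<open>n = 0\<close>).\<close>

definition first_return_prob :: "'v set \<Rightarrow> ('v \<Rightarrow> 'v \<Rightarrow> real) \<Rightarrow> 'v \<Rightarrow> nat \<Rightarrow> real" where
  "first_return_prob G P x n =
     (\<Sum>\<^sub>\<infinity>w\<in>{w. length w + 1 = n \<and> set w \<subseteq> G - {x}}. path_prob P (x # w @ [x]))"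

text \<open>Every state is almost surely revisited, and the return time has finite expectation.\<close>

definition positive_recurrent :: "'v set \<Rightarrow> ('v \<Rightarrow> 'v \<Rightarrow> real) \<Rightarrow> bool" where
  "positive_recurrent G P \<longleftrightarrow>
     (\<forall>x\<in>G. first_return_prob G P x sums 1 \<and>
            summable (\<lambda>n. real n * first_return_prob G P x n))"

definition invariant_probability :: "'v set \<Rightarrow> ('v \<Rightarrow> 'v \<Rightarrow> real) \<Rightarrow> ('v \<Rightarrow> real) \<Rightarrow> bool" where
  "invariant_probability G P \<pi> \<longleftrightarrow>
     (\<forall>x\<in>G. 0 \<le> \<pi> x) \<and> (\<pi> has_sum 1) G \<and>
     (\<forall>y\<in>G. ((\<lambda>x. \<pi> x * P x y) has_sum \<pi> y) G)"


section \<open>The weighted spider network\<close>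

text \<open>\<open>spider_vertex n k\<close> is the vertex \<open>(n, k)\<close>; all the pairs \<open>(0, k)\<close> are identified by
  choosing \<open>(0, 1)\<close> as their representative.\<close>

definition spider_root :: "nat \<times> nat" where
  "spider_root = (0, 1)"

definition spider_vertex :: "nat \<Rightarrow> nat \<Rightarrow> nat \<times> nat" where
  "spider_vertex n k = (if n = 0 then spider_root else (n, k))"

definition spider :: "nat \<Rightarrow> (nat \<times> nat) set" where
  "spider N = {spider_vertex n k |n k. 1 \<le> k \<and> k \<le> N}"

text \<open>The matrix is not symmetric: the edge from the root to the first vertex of leg \<open>k\<close> has
  weight \<open>\<gamma>\<^sub>2 k\<close>, the edge back has weight \<open>\<gamma>\<^sub>3\<close>.\<close>

definition spider_adj ::
    "real \<Rightarrow> (nat \<Rightarrow> real) \<Rightarrow> real \<Rightarrow> nat \<times> nat \<Rightarrow> nat \<times> nat \<Rightarrow> real" where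
  "spider_adj \<gamma>\<^sub>1 \<gamma>\<^sub>2 \<gamma>\<^sub>3 x y =
     (if x = spider_root then
        (if y = spider_root then \<gamma>\<^sub>1 else if fst y = 1 then \<gamma>\<^sub>2 (snd y) else 0)
      else
        (if y = spider_vertex (fst x + 1) (snd x) \<or> y = spider_vertex (fst x - 1) (snd x)
         then \<gamma>\<^sub>3 else 0))"

end

theory Submission
  imports Defs
begin

text \<open>Since \<open>\<Lambda> < 0\<close>, some \<open>g\<close> in the open unit interval makes \<open>\<psi> (n, k) = g\<^sup>n\<close> an eigenfunction,
  with eigenvalue \<open>r = \<gamma>\<^sub>1 + S\<^sub>2 g = \<gamma>\<^sub>3 (g + 1 / g)\<close>. The Markov chain obtained from \<open>A\<close> by
  conjugation with \<open>\<psi>\<close> is irreducible and has an explicit invariant probability, because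
  \<open>g ^ (2 * n)\<close> is summable. Its transition probabilities after \<open>n\<close> steps therefore cannot decay
  exponentially in \<open>n\<close>, so that \<open>r\<close> is the spectral radius, and it is positive recurrent by
  Kac's argument. On a leg, eigenfunctions and invariant measures (divided by \<open>\<psi>\<close>) satisfy the same
  recurrence with fundamental solutions \<open>g\<^sup>n\<close> and \<open>(1 / g)\<^sup>n\<close>; positivity, respectively summability,
  excludes the second one.\<close>

section \<open>Interchange of sums and expectations under a Markov kernel\<close>

lemma has_sum_nonneg_swap:
  fixes f :: "'a \<Rightarrow> 'b \<Rightarrow> real"
  assumes nonneg: "\<And>x y. x \<in> A \<Longrightarrow> y \<in> B \<Longrightarrow> 0 \<le> f x y"
    and rows: "\<And>x. x \<in> A \<Longrightarrow> (f x has_sum g x) B"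
    and cols: "\<And>y. y \<in> B \<Longrightarrow> ((\<lambda>x. f x y) has_sum h y) A"
    and total: "(h has_sum s) B"
  shows "(g has_sum s) A"
proof -
  \<comment> \<open>Tonelli: for nonnegative terms, summability of the column sums already gives
    summability over the product, so the rows may be summed first as well.\<close>
  have "(\<lambda>(y, x). f x y) summable_on (B \<times> A)"
    by (rule summable_on_SigmaI[where g = h])
      (use cols nonneg has_sum_imp_summable[OF total] in auto)
  then have "((\<lambda>(y, x). f x y) has_sum s) (B \<times> A)"
    by (intro has_sum_SigmaI[where g = h]) (use cols total in auto)
  then have "((\<lambda>(x, y). f x y) has_sum s) (A \<times> B)"
    by (subst has_sum_swap) simp
  then show ?thesis
    by (rule has_sum_SigmaD) (use rows in auto)
qed

text \<open>Comparison with the row of \<open>P\<close>, which sums to 1. As \<open>infsum\<close>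
  is 0 by default on families that are not summable, summability is what makes the recursions for
  \<open>mat_pow\<close> and \<open>avoid_prob\<close> meaningful.\<close>

lemma markov_kernel_bounded:
  assumes P: "markov_kernel G P" and x: "x \<in> G"
    and f: "\<And>y. y \<in> G \<Longrightarrow> 0 \<le> f y" "\<And>y. y \<in> G \<Longrightarrow> f y \<le> 1"
  shows "(\<lambda>y. P x y * f y) summable_on G"
    and "0 \<le> (\<Sum>\<^sub>\<infinity>y\<in>G. P x y * f y)"
    and "(\<Sum>\<^sub>\<infinity>y\<in>G. P x y * f y) \<le> 1"
proof -
  have nonneg: "\<And>y. y \<in> G \<Longrightarrow> 0 \<le> P x y" and one: "(P x has_sum 1) G"
    using P x by (auto simp: markov_kernel_def)
  show s: "(\<lambda>y. P x y * f y) summable_on G"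
    by (rule summable_on_comparison_test[OF has_sum_imp_summable[OF one]])
      (use nonneg f in \<open>auto intro: mult_left_le\<close>)
  show "0 \<le> (\<Sum>\<^sub>\<infinity>y\<in>G. P x y * f y)"
    by (rule infsum_nonneg) (use nonneg f in auto)
  show "(\<Sum>\<^sub>\<infinity>y\<in>G. P x y * f y) \<le> 1"
    by (rule has_sum_mono[OF has_sum_infsum[OF s] one]) (use nonneg f in \<open>auto intro: mult_left_le\<close>)
qed

lemma invariant_probability_bounded:
  assumes \<pi>: "invariant_probability G P \<pi>"
    and f: "\<And>y. y \<in> G \<Longrightarrow> 0 \<le> f y" "\<And>y. y \<in> G \<Longrightarrow> f y \<le> 1"
  shows "(\<lambda>y. \<pi> y * f y) summable_on G"
proof -
  have "(\<pi> has_sum 1) G" and "\<And>y. y \<in> G \<Longrightarrow> 0 \<le> \<pi> y"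
    using \<pi> by (auto simp: invariant_probability_def)
  then show ?thesis
    by (intro summable_on_comparison_test[OF has_sum_imp_summable])
      (use f in \<open>auto intro: mult_left_le\<close>)
qed

text \<open>Invariance in its dual form: a stationary chain keeps the expectation of
  \<open>f\<close> after one step. The two sides arise from summing the nonnegative terms
  \<open>\<pi> x * P x y * f y\<close> in the two possible orders.\<close>

lemma invariant_probability_expectation:
  assumes P: "markov_kernel G P" and \<pi>: "invariant_probability G P \<pi>"
    and f: "\<And>y. y \<in> G \<Longrightarrow> 0 \<le> f y" "\<And>y. y \<in> G \<Longrightarrow> f y \<le> 1"
  shows "((\<lambda>x. \<pi> x * (\<Sum>\<^sub>\<infinity>y\<in>G. P x y * f y)) has_sum (\<Sum>\<^sub>\<infinity>y\<in>G. \<pi> y * f y)) G"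
proof (rule has_sum_nonneg_swap[where f = "\<lambda>x y. \<pi> x * (P x y * f y)" and h = "\<lambda>y. \<pi> y * f y"])
  show "0 \<le> \<pi> x * (P x y * f y)" if "x \<in> G" "y \<in> G" for x y
    using that P \<pi> f by (auto simp: markov_kernel_def invariant_probability_def)
  show "((\<lambda>y. \<pi> x * (P x y * f y)) has_sum \<pi> x * (\<Sum>\<^sub>\<infinity>y\<in>G. P x y * f y)) G" if "x \<in> G" for x
    by (intro has_sum_cmult_right has_sum_infsum markov_kernel_bounded[OF P that]) (use f in auto)
  show "((\<lambda>x. \<pi> x * (P x y * f y)) has_sum \<pi> y * f y) G" if "y \<in> G" for y
  proof -
    have "((\<lambda>x. \<pi> x * P x y) has_sum \<pi> y) G"
      using \<pi> that by (auto simp: invariant_probability_def)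
    from has_sum_cmult_left[OF this, of "f y"] show ?thesis
      by (simp add: mult.assoc)
  qed
  show "((\<lambda>y. \<pi> y * f y) has_sum (\<Sum>\<^sub>\<infinity>y\<in>G. \<pi> y * f y)) G"
    by (intro has_sum_infsum invariant_probability_bounded[OF \<pi>]) (use f in auto)
qed


section \<open>Return times and the invariant probability\<close>

text \<open>The probability that the chain started at \<open>y\<close> avoids \<open>x\<close> at all of the times \<open>1, \<dots>, n\<close>.\<close>

primrec avoid_prob :: "'v set \<Rightarrow> ('v \<Rightarrow> 'v \<Rightarrow> real) \<Rightarrow> 'v \<Rightarrow> nat \<Rightarrow> 'v \<Rightarrow> real" where
  "avoid_prob G P x 0 y = 1"
| "avoid_prob G P x (Suc n) y =
     (\<Sum>\<^sub>\<infinity>z\<in>G. P y z * (if z = x then 0 else avoid_prob G P x n z))"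

lemma avoid_prob_bounds:
  assumes P: "markov_kernel G P" and "y \<in> G"
  shows "0 \<le> avoid_prob G P x n y \<and> avoid_prob G P x n y \<le> 1"
  using \<open>y \<in> G\<close>
proof (induction n arbitrary: y)
  case (Suc n)
  then show ?case
    unfolding avoid_prob.simps by (intro conjI markov_kernel_bounded[OF P]) auto
qed auto

lemma has_sum_avoid_prob_Suc:
  assumes P: "markov_kernel G P" and y: "y \<in> G"
  shows "((\<lambda>z. P y z * avoid_prob G P x n z) has_sum avoid_prob G P x (Suc n) y) (G - {x})"
proof -
  have "((\<lambda>z. P y z * (if z = x then 0 else avoid_prob G P x n z)) has_sum
      avoid_prob G P x (Suc n) y) G"
    unfolding avoid_prob.simps
    by (intro has_sum_infsum markov_kernel_bounded(1)[OF P y]) (use avoid_prob_bounds[OF P] in auto)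
  then show ?thesis
    by (subst has_sum_cong_neutral[where T = G]) (auto cong: if_cong)
qed

lemma path_prob_nonneg:
  assumes P: "markov_kernel G P" and "set w \<subseteq> G"
  shows "0 \<le> path_prob P w"
  using assms by (induction P w rule: path_prob.induct) (auto simp: markov_kernel_def)

text \<open>Both sides are the probability that the chain started at \<open>y\<close> visits
  \<open>x\<close> at a positive time for the first time at time \<open>n + 1\<close>. The induction
  splits off the first step, which is why the start \<open>y\<close> is arbitrary.\<close>

lemma has_sum_path_prob_avoid:
  assumes P: "markov_kernel G P" and x: "x \<in> G" and y: "y \<in> G"
  shows "((\<lambda>w. path_prob P (y # w @ [x])) has_sum
           (avoid_prob G P x n y - avoid_prob G P x (Suc n) y))
         {w. length w = n \<and> set w \<subseteq> G - {x}}"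
  using y
proof (induction n arbitrary: y)
  case 0
  \<comment> \<open>Without intermediate states, the claim is that the row sum 1 splits into
    \<open>P y x\<close> and the probability of missing \<open>x\<close>.\<close>
  have "((\<lambda>z. P y z) has_sum 1) G"
    using P 0 by (auto simp: markov_kernel_def)
  moreover have "((\<lambda>z. P y z) has_sum P y x + avoid_prob G P x (Suc 0) y) (insert x (G - {x}))"
    using has_sum_avoid_prob_Suc[OF P 0, of x 0] by (intro has_sum_insert) auto
  ultimately have "1 = P y x + avoid_prob G P x (Suc 0) y"
    using x by (simp only: insert_Diff) (rule has_sum_unique)
  moreover have "{w. length w = 0 \<and> set w \<subseteq> G - {x}} = {[]}"
    by auto
  ultimately show ?case
    by (simp add: has_sum_finiteI del: avoid_prob.simps(2))
next
  case (Suc n)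
  let ?W = "{w. length w = n \<and> set w \<subseteq> G - {x}}"
  let ?d = "\<lambda>n y. avoid_prob G P x n y - avoid_prob G P x (Suc n) y"
  let ?f = "\<lambda>(z, w). P y z * path_prob P (z # w @ [x])"
  have inner: "((\<lambda>w. ?f (z, w)) has_sum P y z * ?d n z) ?W" if "z \<in> G - {x}" for z
    using Suc.IH[of z] that by (simp add: has_sum_cmult_right)
  have outer: "((\<lambda>z. P y z * ?d n z) has_sum ?d (Suc n) y) (G - {x})"
    using has_sum_add[OF has_sum_avoid_prob_Suc[OF P Suc.prems, of x n]
        has_sum_uminusI[OF has_sum_avoid_prob_Suc[OF P Suc.prems, of x "Suc n"]]]
    by (simp add: algebra_simps del: avoid_prob.simps)
  have "?f summable_on ((G - {x}) \<times> ?W)"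
  proof (rule summable_on_SigmaI[OF inner has_sum_imp_summable[OF outer]])
    show "0 \<le> ?f (z, w)" if "z \<in> G - {x}" "w \<in> ?W" for z w
      using that P Suc.prems x
      by (auto intro!: mult_nonneg_nonneg path_prob_nonneg[OF P] simp: markov_kernel_def)
  qed auto
  then have "(?f has_sum ?d (Suc n) y) ((G - {x}) \<times> ?W)"
    by (intro has_sum_SigmaI[OF _ outer] inner)
  moreover have "?f = (\<lambda>w. path_prob P (y # w @ [x])) \<circ> (\<lambda>(z, w). z # w)"
    by auto
  moreover have "inj_on (\<lambda>(z, w). z # w) ((G - {x}) \<times> ?W)"
    by (auto simp: inj_on_def)
  ultimately have "((\<lambda>w. path_prob P (y # w @ [x])) has_sum ?d (Suc n) y)
      ((\<lambda>(z, w). z # w) ` ((G - {x}) \<times> ?W))"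
    by (simp only: has_sum_reindex)
  also have "(\<lambda>(z, w). z # w) ` ((G - {x}) \<times> ?W) = {w. length w = Suc n \<and> set w \<subseteq> G - {x}}"
    by (auto simp: length_Suc_conv image_iff)
  finally show ?case .
qed

lemma first_return_prob_Suc:
  assumes "markov_kernel G P" and "x \<in> G"
  shows "first_return_prob G P x (Suc n) = avoid_prob G P x n x - avoid_prob G P x (Suc n) x"
  unfolding first_return_prob_def
  using infsumI[OF has_sum_path_prob_avoid[OF assms assms(2), of n]] by simp

lemma first_return_prob_0: "first_return_prob G P x 0 = 0"
  by (simp add: first_return_prob_def)

text \<open>The stationary probability of avoiding \<open>x\<close> at the times \<open>1, \<dots>, n\<close> drops, by stationarity,
  by \<open>\<pi> x * avoid_prob G P x n x\<close> when \<open>n\<close> is increased to \<open>n + 1\<close>.\<close>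

lemma sum_avoid_prob_le:
  assumes P: "markov_kernel G P" and \<pi>: "invariant_probability G P \<pi>" and x: "x \<in> G"
  shows "\<pi> x * (\<Sum>i<n. avoid_prob G P x i x) \<le> 1"
proof -
  define s where "s n = avoid_prob G P x n" for n
  define u where "u n = (\<Sum>\<^sub>\<infinity>y\<in>G. \<pi> y * s n y)" for n
  have s: "0 \<le> s n y" "s n y \<le> 1" if "y \<in> G" for n y
    using avoid_prob_bounds[OF P that] by (auto simp: s_def)
  have "\<pi> x * s n x = u n - u (Suc n)" for n
  proof -
    let ?f = "\<lambda>z. if z = x then 0 else s n z"
    \<comment> \<open>One stationary step turns avoidance at the times 1 to \<open>n + 1\<close>
      into avoidance at the times 0 to \<open>n\<close>, that is, into the event of
      \<open>s n\<close> with the starting state \<open>x\<close> removed.\<close>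
    have "((\<lambda>y. \<pi> y * s (Suc n) y) has_sum (\<Sum>\<^sub>\<infinity>y\<in>G. \<pi> y * ?f y)) G"
      unfolding s_def avoid_prob.simps
      by (rule invariant_probability_expectation[OF P \<pi>]) (use s in \<open>auto simp: s_def\<close>)
    then have "u (Suc n) = (\<Sum>\<^sub>\<infinity>y\<in>G. \<pi> y * ?f y)"
      unfolding u_def by (rule infsumI)
    moreover have "((\<lambda>y. \<pi> y * ?f y) has_sum (\<Sum>\<^sub>\<infinity>y\<in>G. \<pi> y * ?f y)) G"
      by (intro has_sum_infsum invariant_probability_bounded[OF \<pi>]) (use s in auto)
    ultimately have "((\<lambda>y. \<pi> y * ?f y) has_sum u (Suc n)) (G - {x})"
      by (subst has_sum_cong_neutral[where T = G]) auto
    then have "((\<lambda>y. \<pi> y * s n y) has_sum u (Suc n)) (G - {x})"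
      by (rule has_sum_cong[THEN iffD1, rotated]) auto
    then have "((\<lambda>y. \<pi> y * s n y) has_sum \<pi> x * s n x + u (Suc n)) (insert x (G - {x}))"
      by (intro has_sum_insert) auto
    then show ?thesis
      using x by (simp add: insert_absorb u_def infsumI)
  qed
  then have "(\<Sum>i<n. \<pi> x * s i x) = u 0 - u n"
    by (simp add: sum_lessThan_telescope')
  moreover have "u 0 = 1"
    using \<pi> by (auto simp: u_def s_def invariant_probability_def infsumI)
  moreover have "0 \<le> u n"
    unfolding u_def by (rule infsum_nonneg) (use s \<pi> in \<open>auto simp: invariant_probability_def\<close>)
  ultimately show ?thesis
    by (simp add: s_def sum_distrib_left)
qed

text \<open>The probabilities \<open>s n\<close> of no return up to time \<open>n\<close> have sum
  at most \<open>1 / \<pi> x\<close>. Hence they tend to 0, which gives recurrence, and their sum,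
  the mean return time, is finite.\<close>

lemma positive_recurrent_if_invariant:
  assumes P: "markov_kernel G P" and \<pi>: "invariant_probability G P \<pi>"
    and pos: "\<And>x. x \<in> G \<Longrightarrow> 0 < \<pi> x"
  shows "positive_recurrent G P"
  unfolding positive_recurrent_def
proof safe
  fix x assume x: "x \<in> G"
  define s where "s n = avoid_prob G P x n x" for n
  define f where "f = first_return_prob G P x"
  have f: "f (Suc n) = s n - s (Suc n)" "f 0 = 0" for n
    using first_return_prob_Suc[OF P x] first_return_prob_0 by (auto simp: s_def f_def)
  have s: "0 \<le> s n" "s 0 = 1" for n
    using avoid_prob_bounds[OF P x] by (auto simp: s_def)
  have bound: "(\<Sum>i<n. s i) \<le> 1 / \<pi> x" for n
    using sum_avoid_prob_le[OF P \<pi> x, of n] pos[OF x] by (simp add: s_def field_simps)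
  have "summable s"
    by (rule summableI_nonneg_bounded[OF s(1) bound])
  then have "s \<longlonglongrightarrow> 0"
    by (rule summable_LIMSEQ_zero)
  moreover have "(\<Sum>i<Suc n. f i) = 1 - s n" for n
    by (induction n) (auto simp: f s)
  ultimately have "(\<lambda>n. \<Sum>i<Suc n. f i) \<longlonglongrightarrow> 1"
    using tendsto_diff[OF tendsto_const[of 1], of s 0] by simp
  then show "f sums 1"
    unfolding sums_def by (subst (asm) filterlim_sequentially_Suc)
  have nonneg: "0 \<le> f n" for n
  proof (cases n)
    case (Suc m)
    then have "0 \<le> avoid_prob G P x m x - avoid_prob G P x (Suc m) x"
      by (intro has_sum_nonneg[OF has_sum_path_prob_avoid[OF P x x]] path_prob_nonneg[OF P])
        (use x in auto)
    then show ?thesis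
      using Suc by (simp add: f s_def)
  qed (simp add: f)
  \<comment> \<open>Summation by parts. The subtracted boundary term \<open>n * s n\<close> is
    nonnegative, so the bound on the sum of \<open>s\<close> carries over.\<close>
  have "(\<Sum>i<Suc n. real i * f i) = (\<Sum>i<n. s i) - n * s n" for n
    by (induction n) (auto simp: f s algebra_simps)
  then have "(\<Sum>i<Suc n. real i * f i) \<le> 1 / \<pi> x" for n
    using bound[of n] s(1)[of n] by (smt (verit) mult_nonneg_nonneg of_nat_0_le_iff)
  moreover have "(\<Sum>i<n. real i * f i) \<le> (\<Sum>i<Suc n. real i * f i)" for n
    using nonneg by simp
  ultimately have "(\<Sum>i<n. real i * f i) \<le> 1 / \<pi> x" for n
    by (meson order_trans)
  then show "summable (\<lambda>n. real n * f n)"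
    by (intro summableI_nonneg_bounded) (use nonneg in auto)
qed


section \<open>The spectral radius of a positive recurrent matrix\<close>

lemma mat_pow_bounds:
  assumes P: "markov_kernel G P" and "x \<in> G"
  shows "0 \<le> mat_pow G P n x y \<and> mat_pow G P n x y \<le> 1"
  using \<open>x \<in> G\<close>
proof (induction n arbitrary: x)
  case (Suc n)
  then show ?case
    unfolding mat_pow.simps by (intro conjI markov_kernel_bounded[OF P]) auto
qed auto

text \<open>Chapman-Kolmogorov, restricted to the trajectories that are at \<open>y\<close> at time
  \<open>m\<close>.\<close>

lemma mat_pow_supermult:
  assumes P: "markov_kernel G P" and "x \<in> G" and y: "y \<in> G"
  shows "mat_pow G P m x y * mat_pow G P n y z \<le> mat_pow G P (m + n) x z"
  using \<open>x \<in> G\<close>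
proof (induction m arbitrary: x)
  case 0
  then show ?case
    using mat_pow_bounds[OF P] by auto
next
  case (Suc m)
  have "mat_pow G P (Suc m) x y * mat_pow G P n y z
      = (\<Sum>\<^sub>\<infinity>w\<in>G. P x w * (mat_pow G P m w y * mat_pow G P n y z))"
    by (simp add: infsum_cmult_left' flip: mult.assoc)
  also have "\<dots> \<le> (\<Sum>\<^sub>\<infinity>w\<in>G. P x w * mat_pow G P (m + n) w z)"
  proof (rule infsum_mono)
    show "P x w * (mat_pow G P m w y * mat_pow G P n y z) \<le> P x w * mat_pow G P (m + n) w z"
      if "w \<in> G" for w
      using Suc.IH[OF that] P Suc.prems that by (auto simp: markov_kernel_def intro: mult_left_mono)
  qed (use mat_pow_bounds[OF P] y in \<open>auto intro!: markov_kernel_bounded(1)[OF P Suc.prems] mult_le_one\<close>)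
  finally show ?case by simp
qed

lemma mat_pow_1:
  assumes "y \<in> G"
  shows "mat_pow G P 1 x y = P x y"
proof -
  have "((\<lambda>z. P x z * (if z = y then 1 else 0)) has_sum P x y) G"
    by (rule has_sum_finite_neutralI[of "{y}"]) (use assms in auto)
  then show ?thesis
    by (simp add: infsumI)
qed

lemma mat_pow_pos_trans:
  assumes P: "markov_kernel G P" and "x \<in> G" "y \<in> G"
    and "\<exists>m. 0 < mat_pow G P m x y" "\<exists>m. 0 < mat_pow G P m y z"
  shows "\<exists>m. 0 < mat_pow G P m x z"
proof -
  obtain m n where "0 < mat_pow G P m x y" "0 < mat_pow G P n y z"
    using assms by blast
  then have "0 < mat_pow G P (m + n) x z"
    using mat_pow_supermult[OF P assms(2,3), of m n z] by (smt (verit) mult_pos_pos)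
  then show ?thesis ..
qed

text \<open>The recursion of \<open>mat_pow\<close> multiplies by \<open>P\<close> on the left, so
  the induction step uses the dual form of invariance.\<close>

lemma has_sum_invariant_mat_pow:
  assumes P: "markov_kernel G P" and \<pi>: "invariant_probability G P \<pi>" and y: "y \<in> G"
  shows "((\<lambda>x. \<pi> x * mat_pow G P n x y) has_sum \<pi> y) G"
proof (induction n)
  case 0
  show ?case
    by (rule has_sum_finite_neutralI[of "{y}"]) (use y in auto)
next
  case (Suc n)
  then show ?case
    using invariant_probability_expectation[OF P \<pi>, of "\<lambda>x. mat_pow G P n x y"]
      mat_pow_bounds[OF P] by (simp add: infsumI)
qed

text \<open>If the radius of convergence exceeded 1, then all \<open>mat_pow G P n x y\<close> would tend to 0 by
  irreducibility, which contradicts \<open>\<pi> P\<^sup>n = \<pi>\<close>.\<close>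

lemma conv_radius_mat_pow_eq_1:
  assumes P: "markov_kernel G P" and \<pi>: "invariant_probability G P \<pi>"
    and irred: "\<And>x y. x \<in> G \<Longrightarrow> y \<in> G \<Longrightarrow> \<exists>m. 0 < mat_pow G P m x y"
    and x: "x \<in> G" and y: "y \<in> G" and pos: "0 < \<pi> y"
  shows "conv_radius (\<lambda>n. mat_pow G P n x y) = 1"
proof (rule antisym)
  let ?M = "mat_pow G P"
  show "1 \<le> conv_radius (\<lambda>n. ?M n x y)"
  proof (rule conv_radius_geI_ex')
    fix r :: real assume r: "0 < r" "ereal r < 1"
    show "summable (\<lambda>n. ?M n x y * of_real r ^ n)"
    proof (rule summable_comparison_test'[of "\<lambda>n. r ^ n"])
      show "summable (\<lambda>n. r ^ n)"
        using r by (simp add: one_ereal_def)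
      show "norm (?M n x y * of_real r ^ n) \<le> r ^ n" for n
        using mat_pow_bounds[OF P x, of n y] r by (simp add: abs_mult mult_left_le_one_le)
    qed
  qed
  show "conv_radius (\<lambda>n. ?M n x y) \<le> 1"
  proof (rule ccontr)
    assume "\<not> ?thesis"
    then have "summable (\<lambda>n. ?M n x y * 1 ^ n)"
      by (intro summable_in_conv_radius) (simp add: one_ereal_def)
    then have lim: "(\<lambda>n. ?M n x y) \<longlonglongrightarrow> 0"
      by (simp add: summable_LIMSEQ_zero)
    \<comment> \<open>Since \<open>z\<close> is reached from \<open>x\<close> in some
      \<open>m\<close> steps with positive probability, the decay seen from \<open>x\<close> is
      inherited by every starting state \<open>z\<close>.\<close>
    have lim': "(\<lambda>n. ?M n z y) \<longlonglongrightarrow> 0" if z: "z \<in> G" for z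
    proof -
      obtain m where m: "0 < ?M m x z"
        using irred[OF x z] by blast
      have "(\<lambda>n. ?M (m + n) x y / ?M m x z) \<longlonglongrightarrow> 0 / ?M m x z"
        by (intro tendsto_divide LIMSEQ_ignore_initial_segment[OF lim, of m, simplified add.commute[of _ m]])
          (use m in auto)
      moreover have "\<bar>?M n z y\<bar> \<le> ?M (m + n) x y / ?M m x z" for n
        using mat_pow_bounds[OF P z, of n y] mat_pow_supermult[OF P x z, of m n y] m
        by (simp add: field_simps)
      ultimately show ?thesis
        by (intro Lim_null_comparison[where f = "\<lambda>n. ?M n z y"]) auto
    qed
    have \<pi>_nonneg: "0 \<le> \<pi> z" if "z \<in> G" for z
      using \<pi> that by (auto simp: invariant_probability_def)
    have \<pi>1: "(\<pi> has_sum 1) G"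
      using \<pi> by (auto simp: invariant_probability_def)
    \<comment> \<open>The states outside the finite set \<open>F\<close> have mass at most
      \<open>\<pi> y / 2\<close>. As \<open>?M n z y\<close> is at most 1, at least half of the
      constant value \<open>\<pi> y\<close> must come from \<open>F\<close>, where the limit can be
      taken termwise.\<close>
    obtain F where F: "finite F" "F \<subseteq> G" "dist (sum \<pi> F) 1 \<le> \<pi> y / 2"
      using has_sum_finite_approximation[OF \<pi>1, of "\<pi> y / 2"] pos by auto
    have "\<pi> y / 2 \<le> (\<Sum>z\<in>F. \<pi> z * ?M n z y)" for n
    proof -
      have 1: "((\<lambda>z. \<pi> z * ?M n z y) has_sum (\<pi> y - (\<Sum>z\<in>F. \<pi> z * ?M n z y))) (G - F)"
        by (intro has_sum_Diff has_sum_invariant_mat_pow[OF P \<pi> y] has_sum_finite F)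
      have 2: "(\<pi> has_sum (1 - sum \<pi> F)) (G - F)"
        by (intro has_sum_Diff \<pi>1 has_sum_finite F)
      have "\<pi> y - (\<Sum>z\<in>F. \<pi> z * ?M n z y) \<le> 1 - sum \<pi> F"
        by (rule has_sum_mono[OF 1 2]) (use \<pi>_nonneg mat_pow_bounds[OF P] in \<open>auto intro: mult_left_le\<close>)
      then show ?thesis
        using F(3) unfolding dist_real_def by linarith
    qed
    moreover have "(\<lambda>n. \<Sum>z\<in>F. \<pi> z * ?M n z y) \<longlonglongrightarrow> (\<Sum>z\<in>F. \<pi> z * 0)"
      by (intro tendsto_sum tendsto_mult tendsto_const lim') (use F in auto)
    ultimately have "\<pi> y / 2 \<le> 0"
      by (intro LIMSEQ_le_const[of _ 0]) auto
    then show False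
      using pos by simp
  qed
qed

text \<open>The Doob transform of \<open>A\<close>: dividing the eigenvalue equation at
  \<open>x\<close> by \<open>r * \<psi> x\<close> makes the row sum 1.\<close>

lemma markov_kernel_of_eigenfunction:
  assumes A: "\<And>x y. x \<in> G \<Longrightarrow> y \<in> G \<Longrightarrow> 0 \<le> A x y" and r: "0 < r"
    and \<psi>: "positive_eigenfunction G A r \<psi>"
  shows "markov_kernel G (\<lambda>x y. A x y * (\<psi> y / (r * \<psi> x)))"
  unfolding markov_kernel_def
proof safe
  fix x assume x: "x \<in> G"
  then have \<psi>x: "0 < \<psi> x" and sum: "((\<lambda>y. A x y * \<psi> y) has_sum (r * \<psi> x)) G"
    using \<psi> by (auto simp: positive_eigenfunction_def)
  show "0 \<le> A x y * (\<psi> y / (r * \<psi> x))" if "y \<in> G" for y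
    using A[OF x that] \<psi> that \<psi>x r by (auto simp: positive_eigenfunction_def less_imp_le)
  show "((\<lambda>y. A x y * (\<psi> y / (r * \<psi> x))) has_sum 1) G"
    using has_sum_cmult_left[OF sum, of "1 / (r * \<psi> x)"] \<psi>x r by simp
qed

text \<open>Along a path the ratios of \<open>\<psi>\<close> telescope to the endpoints, and each
  step contributes one factor \<open>r\<close>.\<close>

lemma mat_pow_conjugate:
  assumes r: "0 < r" and \<psi>: "\<And>x. x \<in> G \<Longrightarrow> (0::real) < \<psi> x"
    and P: "\<And>x y. x \<in> G \<Longrightarrow> y \<in> G \<Longrightarrow> P x y = A x y * (\<psi> y / (r * \<psi> x))"
    and "x \<in> G" and y: "y \<in> G"
  shows "mat_pow G A n x y = r ^ n * (\<psi> x / \<psi> y * mat_pow G P n x y)"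
  using \<open>x \<in> G\<close>
proof (induction n arbitrary: x)
  case 0
  then show ?case using \<psi>[OF y] by auto
next
  case (Suc n)
  have "A x z * mat_pow G A n z y = r ^ Suc n * (\<psi> x / \<psi> y) * (P x z * mat_pow G P n z y)"
    if "z \<in> G" for z
    unfolding Suc.IH[OF that] P[OF Suc.prems that]
    using \<psi>[OF that] \<psi>[OF Suc.prems] \<psi>[OF y] r by simp
  then have "mat_pow G A (Suc n) x y
      = (\<Sum>\<^sub>\<infinity>z\<in>G. r ^ Suc n * (\<psi> x / \<psi> y) * (P x z * mat_pow G P n z y))"
    by (auto intro: infsum_cong)
  also have "\<dots> = r ^ Suc n * (\<psi> x / \<psi> y) * (\<Sum>\<^sub>\<infinity>z\<in>G. P x z * mat_pow G P n z y)"
    by (rule infsum_cmult_right')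
  finally show ?case by simp
qed

text \<open>Conjugation multiplies the coefficients by \<open>r ^ n\<close> and a positive constant,
  so the radius of convergence 1 for \<open>P\<close> becomes \<open>1 / r\<close> for
  \<open>A\<close>.\<close>

lemma comb_spectral_radius_eqI:
  assumes P: "markov_kernel G P" and \<pi>: "invariant_probability G P \<pi>"
    and irred: "\<And>x y. x \<in> G \<Longrightarrow> y \<in> G \<Longrightarrow> \<exists>m. 0 < mat_pow G P m x y"
    and r: "0 < r" and \<psi>: "\<And>x. x \<in> G \<Longrightarrow> (0::real) < \<psi> x"
    and PA: "\<And>x y. x \<in> G \<Longrightarrow> y \<in> G \<Longrightarrow> P x y = A x y * (\<psi> y / (r * \<psi> x))"
    and x: "x \<in> G" and y: "y \<in> G" and pos: "0 < \<pi> y"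
  shows "comb_spectral_radius G A x y = r"
proof -
  have "conv_radius (\<lambda>n. mat_pow G A n x y)
      = conv_radius (\<lambda>n. r ^ n * (\<psi> x / \<psi> y * mat_pow G P n x y))"
    by (simp only: mat_pow_conjugate[OF r \<psi> PA x y])
  also have "\<dots> = conv_radius (\<lambda>n. mat_pow G P n x y) / ereal (norm r)"
    using r \<psi>[OF x] \<psi>[OF y]
    by (subst conv_radius_mult_power) (auto simp: conv_radius_cmult_left[of "\<psi> x / \<psi> y", simplified])
  also have "\<dots> = ereal (1 / r)"
    using r conv_radius_mat_pow_eq_1[OF P \<pi> irred x y pos] by (simp add: one_ereal_def)
  finally have "conv_radius (\<lambda>n. mat_pow G A n x y) = ereal (1 / r)" .
  then show ?thesis
    unfolding comb_spectral_radius_def by (simp only:) (use r in simp)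
qed

section \<open>The supercritical spider\<close>

text \<open>The characteristic polynomial of the recurrence is \<open>(t - g) * (t - 1 / g)\<close>.
  The combination on the left annihilates the solution \<open>g ^ n\<close> and is divided by
  \<open>g\<close> at every step.\<close>

lemma linear_recurrence_defect:
  fixes u :: "nat \<Rightarrow> real"
  assumes g: "g \<noteq> 0" and u: "\<And>n. u n + u (Suc (Suc n)) = (g + 1 / g) * u (Suc n)"
  shows "u (Suc n) - g * u n = (u 1 - g * u 0) / g ^ n"
proof (induction n)
  case (Suc n)
  have "u (Suc (Suc n)) - g * u (Suc n) = (u (Suc n) - g * u n) / g"
    using u[of n] g by (simp add: field_simps)
  then show ?case
    using Suc g by (simp add: field_simps)
qed simp

lemma linear_recurrence_geometric:
  fixes u :: "nat \<Rightarrow> real"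
  assumes g: "g \<noteq> 0" and u: "\<And>n. u n + u (Suc (Suc n)) = (g + 1 / g) * u (Suc n)"
    and start: "u 1 = g * u 0"
  shows "u n = u 0 * g ^ n"
proof (induction n)
  case (Suc n)
  then show ?case
    using linear_recurrence_defect[of g u n, OF g u] start by simp
qed simp

text \<open>If \<open>u 1 - g * u 0\<close> were negative, \<open>u\<close> would be nonincreasing,
  hence bounded by \<open>u 0\<close>, while the amount subtracted at each step grows like
  \<open>(1 / g) ^ n\<close>. Eventually \<open>u\<close> would become negative.\<close>

lemma linear_recurrence_nonneg_defect:
  fixes u :: "nat \<Rightarrow> real"
  assumes g: "0 < g" "g < 1" and u: "\<And>n. u n + u (Suc (Suc n)) = (g + 1 / g) * u (Suc n)"
    and nonneg: "\<And>n. 0 \<le> u n"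
  shows "g * u 0 \<le> u 1"
proof (rule ccontr)
  define d where "d = g * u 0 - u 1"
  assume "\<not> g * u 0 \<le> u 1"
  then have d: "0 < d"
    by (simp add: d_def)
  have step: "u (Suc n) = g * u n - d / g ^ n" for n
    using linear_recurrence_defect[of g u n] g u by (simp add: d_def field_simps)
  have pos: "0 < d / g ^ n" for n
    using d g by simp
  have gu: "g * u n \<le> u n" for n
    using nonneg[of n] g by (simp add: mult_left_le_one_le)
  have "u (Suc n) \<le> u n" for n
    using step[of n] gu[of n] pos[of n] by linarith
  then have le: "u n \<le> u 0" for n
    by (induction n) (auto intro: order_trans)
  obtain n where "u 0 / d < (1 / g) ^ n"
    using real_arch_pow[of "1 / g" "u 0 / d"] g by auto
  then have "u 0 < d / g ^ n"
    using d by (simp add: field_simps power_one_over)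
  then have "u (Suc n) < 0"
    using step[of n] gu[of n] le[of n] by linarith
  then show False
    using nonneg[of "Suc n"] by simp
qed

text \<open>The parameter \<open>g\<close> is the decay rate for which \<open>g\<^sup>n\<close> is an eigenfunction. The assumption
  \<open>balance\<close> says that the eigenvalues \<open>\<gamma>\<^sub>1 + S g\<close> required at the root and \<open>\<gamma>\<^sub>3 (g + 1 / g)\<close>
  required on the legs agree.\<close>

locale supercritical_spider =
  fixes N :: nat and \<gamma>\<^sub>1 :: real and \<gamma>\<^sub>2 :: "nat \<Rightarrow> real" and \<gamma>\<^sub>3 S g r :: real
  assumes N: "1 \<le> N" and \<gamma>\<^sub>1: "0 \<le> \<gamma>\<^sub>1" and \<gamma>\<^sub>2: "\<And>k. k \<in> {1..N} \<Longrightarrow> 0 < \<gamma>\<^sub>2 k" and \<gamma>\<^sub>3: "0 < \<gamma>\<^sub>3"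
    and S: "S = (\<Sum>k=1..N. \<gamma>\<^sub>2 k)" and g: "0 < g" "g < 1"
    and r: "r = \<gamma>\<^sub>1 + S * g" and balance: "r = \<gamma>\<^sub>3 * (g + 1 / g)"
begin

abbreviation "G \<equiv> spider N"
abbreviation "A \<equiv> spider_adj \<gamma>\<^sub>1 \<gamma>\<^sub>2 \<gamma>\<^sub>3"

text \<open>The Doob transform by the eigenfunction \<open>g ^ fst x\<close>, where
  \<open>fst x\<close> is the distance of \<open>x\<close> from the root.\<close>

definition MERW :: "nat \<times> nat \<Rightarrow> nat \<times> nat \<Rightarrow> real" where
  "MERW x y = A x y * (g ^ fst y / (r * g ^ fst x))"

text \<open>The product of the right eigenfunction with a left one, equal to
  \<open>\<gamma>\<^sub>3\<close> at the root and to \<open>\<gamma>\<^sub>2 k * g ^ n\<close> on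
  leg \<open>k\<close>. The last factor is the inverse of the total mass
  \<open>\<gamma>\<^sub>3 + S * g\<^sup>2 / (1 - g\<^sup>2)\<close>.\<close>

definition stationary :: "nat \<times> nat \<Rightarrow> real" where
  "stationary x = (if x = spider_root then \<gamma>\<^sub>3 else \<gamma>\<^sub>2 (snd x) * g ^ (2 * fst x)) *
     ((1 - g\<^sup>2) / (S * g\<^sup>2 + \<gamma>\<^sub>3 * (1 - g\<^sup>2)))"

section \<open>Positivity of the constants and the vertex set\<close>

lemma S_pos: "0 < S"
  unfolding S using N \<gamma>\<^sub>2 by (intro sum_pos) auto

lemma r_pos: "0 < r"
  using r S_pos \<gamma>\<^sub>1 g by (simp add: add_nonneg_pos)

lemma g_sq_less_1: "g\<^sup>2 < 1"
  using g by (simp add: power_less_one_iff)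

lemma denominator_pos: "0 < S * g\<^sup>2 + \<gamma>\<^sub>3 * (1 - g\<^sup>2)"
  using S_pos \<gamma>\<^sub>3 g g_sq_less_1 by (intro add_pos_pos mult_pos_pos) auto

lemma spider_vertex_0 [simp]: "spider_vertex 0 k = spider_root"
  and spider_vertex_Suc [simp]: "spider_vertex (Suc n) k = (Suc n, k)"
  and fst_spider_vertex [simp]: "fst (spider_vertex n k) = n"
  and fst_spider_root [simp]: "fst spider_root = 0"
  and Suc_neq_spider_root [simp]: "(Suc n, k) \<noteq> spider_root" "spider_root \<noteq> (Suc n, k)"
  by (auto simp: spider_vertex_def spider_root_def)

lemma G_eq: "G = insert spider_root ({1..} \<times> {1..N})"
proof -
  have "spider_root \<in> G"
    using N unfolding spider_def by (force intro: exI[of _ 0])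
  moreover have "(n, k) \<in> G" if "1 \<le> n" "k \<in> {1..N}" for n k
  proof -
    have "(n, k) = spider_vertex n k"
      using that by (simp add: spider_vertex_def)
    then show ?thesis
      using that unfolding spider_def by auto
  qed
  moreover have "spider_vertex n k \<in> insert spider_root ({1..} \<times> {1..N})" if "1 \<le> k" "k \<le> N" for n k
    using that by (auto simp: spider_vertex_def)
  ultimately show ?thesis
    unfolding spider_def by blast
qed

lemma spider_cases:
  assumes "x \<in> G"
  obtains "x = spider_root" | n k where "k \<in> {1..N}" "x = (Suc n, k)"
proof -
  consider "x = spider_root" | "x \<in> {1..} \<times> {1..N}"
    using assms G_eq by auto
  then show ?thesis
  proof cases
    case 2
    then show ?thesis
      by (cases x; cases "fst x") (use that in auto)
  qed (use that in auto)
qed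

lemma root_in_G [simp]: "spider_root \<in> G"
  and Suc_in_G [simp]: "k \<in> {1..N} \<Longrightarrow> (Suc n, k) \<in> G"
  by (auto simp: G_eq)

lemma spider_vertex_in_G [simp]: "k \<in> {1..N} \<Longrightarrow> spider_vertex n k \<in> G"
  by (cases n) auto

lemma ex_leg: "\<exists>k. k \<in> {1..N}"
  using N by auto

section \<open>Rows and columns of the adjacency matrix\<close>

lemma A_nonneg: "x \<in> G \<Longrightarrow> y \<in> G \<Longrightarrow> 0 \<le> A x y"
  using \<gamma>\<^sub>1 \<gamma>\<^sub>2 \<gamma>\<^sub>3 by (auto simp: spider_adj_def G_eq less_imp_le)

lemma A_simps [simp]:
  "A spider_root spider_root = \<gamma>\<^sub>1"
  "A spider_root (Suc 0, k) = \<gamma>\<^sub>2 k"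
  "A (Suc n, k) (Suc (Suc n), k) = \<gamma>\<^sub>3"
  "A (Suc n, k) (spider_vertex n k) = \<gamma>\<^sub>3"
  by (auto simp: spider_adj_def)

text \<open>The support is finite and \<open>f\<close> is arbitrary: for a known \<open>f\<close>
  this verifies an eigenvalue equation, for an unknown one \<open>has_sum_unique\<close> extracts a
  linear relation between its values.\<close>

lemma has_sum_A_root:
  "((\<lambda>y. A spider_root y * f y) has_sum
      (\<gamma>\<^sub>1 * f spider_root + (\<Sum>k=1..N. \<gamma>\<^sub>2 k * f (Suc 0, k)))) G"
proof (rule has_sum_finite_neutralI)
  let ?B = "insert spider_root (Pair (Suc 0) ` {1..N})"
  show "finite ?B" "?B \<subseteq> G"
    by auto
  show "A spider_root y * f y = 0" if "y \<in> G - ?B" for y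
    using that by (auto simp: spider_adj_def G_eq)
  have "sum h (Pair (Suc 0) ` {1..N}) = (\<Sum>k=1..N. h (Suc 0, k))" for h :: "nat \<times> nat \<Rightarrow> real"
    by (subst sum.reindex) (auto simp: inj_on_def)
  then show "\<gamma>\<^sub>1 * f spider_root + (\<Sum>k=1..N. \<gamma>\<^sub>2 k * f (Suc 0, k)) = (\<Sum>y\<in>?B. A spider_root y * f y)"
    by (subst sum.insert) auto
qed

lemma has_sum_A_leg:
  assumes "k \<in> {1..N}"
  shows "((\<lambda>y. A (Suc n, k) y * f y) has_sum
      \<gamma>\<^sub>3 * (f (spider_vertex n k) + f (Suc (Suc n), k))) G"
proof (rule has_sum_finite_neutralI)
  let ?B = "{spider_vertex n k, (Suc (Suc n), k)}"
  show "finite ?B" "?B \<subseteq> G"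
    using assms by auto
  show "A (Suc n, k) y * f y = 0" if "y \<in> G - ?B" for y
    using that by (auto simp: spider_adj_def)
  have "spider_vertex n k \<noteq> (Suc (Suc n), k)"
    by (cases n) auto
  then show "\<gamma>\<^sub>3 * (f (spider_vertex n k) + f (Suc (Suc n), k)) = (\<Sum>y\<in>?B. A (Suc n, k) y * f y)"
    by (simp add: algebra_simps)
qed

lemma has_sum_A_col_root:
  "((\<lambda>x. f x * A x spider_root) has_sum
      (\<gamma>\<^sub>1 * f spider_root + \<gamma>\<^sub>3 * (\<Sum>k=1..N. f (Suc 0, k)))) G"
proof (rule has_sum_finite_neutralI)
  let ?B = "insert spider_root (Pair (Suc 0) ` {1..N})"
  show "finite ?B" "?B \<subseteq> G"
    by auto
  show "f x * A x spider_root = 0" if "x \<in> G - ?B" for x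
  proof -
    from that have "x \<in> G" by simp
    then show ?thesis
    proof (cases rule: spider_cases)
      case (2 n k)
      then show ?thesis
        using that by (cases n) (auto simp: spider_adj_def)
    qed (use that in simp)
  qed
  have "sum h (Pair (Suc 0) ` {1..N}) = (\<Sum>k=1..N. h (Suc 0, k))" for h :: "nat \<times> nat \<Rightarrow> real"
    by (subst sum.reindex) (auto simp: inj_on_def)
  moreover have "A (Suc 0, k) spider_root = \<gamma>\<^sub>3" for k
    using A_simps(4)[of 0 k] by simp
  ultimately show "\<gamma>\<^sub>1 * f spider_root + \<gamma>\<^sub>3 * (\<Sum>k=1..N. f (Suc 0, k)) = (\<Sum>x\<in>?B. f x * A x spider_root)"
    by (subst sum.insert) (auto simp: sum_distrib_left mult.commute)
qed

text \<open>The case distinction reflects the asymmetry of the matrix: the first vertex of a leg is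
  entered from the root with weight \<open>\<gamma>\<^sub>2 k\<close>, all other edges into the
  leg's vertices have weight \<open>\<gamma>\<^sub>3\<close>.\<close>

lemma has_sum_A_col_leg:
  assumes "k \<in> {1..N}"
  shows "((\<lambda>x. f x * A x (Suc n, k)) has_sum
      ((if n = 0 then \<gamma>\<^sub>2 k else \<gamma>\<^sub>3) * f (spider_vertex n k) + \<gamma>\<^sub>3 * f (Suc (Suc n), k))) G"
proof (rule has_sum_finite_neutralI)
  let ?B = "{spider_vertex n k, (Suc (Suc n), k)}"
  show "finite ?B" "?B \<subseteq> G"
    using assms by auto
  show "f x * A x (Suc n, k) = 0" if "x \<in> G - ?B" for x
  proof -
    from that have "x \<in> G" by simp
    then show ?thesis
    proof (cases rule: spider_cases)
      case 1
      then show ?thesis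
        using that by (cases n) (auto simp: spider_adj_def)
    next
      case (2 m j)
      then show ?thesis
        using that by (cases m; cases n) (auto simp: spider_adj_def)
    qed
  qed
  have "spider_vertex n k \<noteq> (Suc (Suc n), k)"
    by (cases n) auto
  moreover have "A (spider_vertex n k) (Suc n, k) = (if n = 0 then \<gamma>\<^sub>2 k else \<gamma>\<^sub>3)"
    by (cases n) auto
  moreover have "A (Suc (Suc n), k) (Suc n, k) = \<gamma>\<^sub>3"
    using A_simps(4)[of "Suc n" k] by simp
  ultimately show "(if n = 0 then \<gamma>\<^sub>2 k else \<gamma>\<^sub>3) * f (spider_vertex n k) + \<gamma>\<^sub>3 * f (Suc (Suc n), k)
      = (\<Sum>x\<in>?B. f x * A x (Suc n, k))"
    by (simp add: algebra_simps)
qed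

section \<open>Positive eigenfunctions\<close>

lemma positive_eigenfunction_geometric:
  assumes c: "0 < c" and \<psi>: "\<And>n k. k \<in> {1..N} \<Longrightarrow> \<psi> (spider_vertex n k) = c * g ^ n"
  shows "positive_eigenfunction G A r \<psi>"
proof -
  have root: "\<psi> spider_root = c"
    using ex_leg \<psi>[of _ 0] by auto
  have leg: "\<psi> (Suc n, k) = c * g ^ Suc n" if "k \<in> {1..N}" for n k
    using \<psi>[OF that, of "Suc n"] by simp
  show ?thesis
    unfolding positive_eigenfunction_def
  proof safe
    fix x assume "x \<in> G"
    then show "0 < \<psi> x"
      by (cases rule: spider_cases) (use c g in \<open>auto simp: root leg\<close>)
    show "((\<lambda>y. A x y * \<psi> y) has_sum r * \<psi> x) G"
      using \<open>x \<in> G\<close>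
    proof (cases rule: spider_cases)
      case 1
      have "(\<Sum>k=1..N. \<gamma>\<^sub>2 k * \<psi> (Suc 0, k)) = S * (c * g)"
        unfolding S sum_distrib_right by (intro sum.cong) (auto simp: leg)
      then show ?thesis
        using has_sum_A_root[of \<psi>] 1 by (simp add: root r algebra_simps)
    next
      case (2 n k)
      \<comment> \<open>The two neighbours contribute the factors \<open>1 / g\<close> and
        \<open>g\<close>, so \<open>balance\<close> identifies the eigenvalue as
        \<open>r\<close>.\<close>
      have "\<gamma>\<^sub>3 * (\<psi> (spider_vertex n k) + \<psi> (Suc (Suc n), k)) = r * \<psi> x"
        using 2 \<psi>[OF 2(1), of n] g by (simp add: leg balance field_simps)
      then show ?thesis
        using has_sum_A_leg[OF 2(1), of n \<psi>] 2 by simp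
    qed
  qed
qed

text \<open>Positivity on leg \<open>k\<close> only gives that the excess
  \<open>u k 1 - g * u k 0\<close> is nonnegative. The root equation, with
  \<open>r = \<gamma>\<^sub>1 + S * g\<close>, says that the excesses weighted by
  \<open>\<gamma>\<^sub>2 k\<close> add up to 0. Hence all of them vanish, and only the decaying
  solution remains on every leg.\<close>

lemma positive_eigenfunction_unique:
  assumes \<psi>: "positive_eigenfunction G A r \<psi>" and k: "k \<in> {1..N}"
  shows "\<psi> (spider_vertex n k) = \<psi> spider_root * g ^ n"
proof -
  have pos: "0 < \<psi> x" and eig: "((\<lambda>y. A x y * \<psi> y) has_sum r * \<psi> x) G" if "x \<in> G" for x
    using \<psi> that by (auto simp: positive_eigenfunction_def)
  define u where "u k n = \<psi> (spider_vertex n k)" for k n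
  have rec: "u k n + u k (Suc (Suc n)) = (g + 1 / g) * u k (Suc n)" if "k \<in> {1..N}" for n k
    using has_sum_unique[OF has_sum_A_leg[OF that, of n \<psi>] eig] that \<gamma>\<^sub>3
    by (simp add: u_def balance)
  have le: "g * \<psi> spider_root \<le> u k 1" if "k \<in> {1..N}" for k
    using linear_recurrence_nonneg_defect[OF g, of "u k"] rec[OF that] pos that
    by (simp add: u_def less_imp_le)
  have "\<gamma>\<^sub>1 * \<psi> spider_root + (\<Sum>k=1..N. \<gamma>\<^sub>2 k * u k 1) = r * \<psi> spider_root"
    using has_sum_unique[OF has_sum_A_root eig[of spider_root]] by (simp add: u_def)
  then have "(\<Sum>k=1..N. \<gamma>\<^sub>2 k * (u k 1 - g * \<psi> spider_root)) = 0"
    by (simp add: r S right_diff_distrib sum_subtractf flip: sum_distrib_right) (simp add: algebra_simps)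
  then have "\<gamma>\<^sub>2 k * (u k 1 - g * \<psi> spider_root) = 0"
    using k le \<gamma>\<^sub>2 by (subst (asm) sum_nonneg_eq_0_iff) (auto simp: less_imp_le)
  then have "u k 1 = g * u k 0"
    using \<gamma>\<^sub>2[OF k] by (simp add: u_def)
  then have "u k n = u k 0 * g ^ n"
    using linear_recurrence_geometric[of g "u k" n] rec[OF k] g by auto
  then show ?thesis
    by (simp add: u_def)
qed

lemma positive_eigenfunction_iff:
  "positive_eigenfunction G A r \<psi> \<longleftrightarrow>
     (\<exists>c>0. \<forall>n. \<forall>k\<in>{1..N}. \<psi> (spider_vertex n k) = c * g ^ n)"
proof
  assume "positive_eigenfunction G A r \<psi>"
  then show "\<exists>c>0. \<forall>n. \<forall>k\<in>{1..N}. \<psi> (spider_vertex n k) = c * g ^ n"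
    using positive_eigenfunction_unique[of \<psi>]
    by (intro exI[of _ "\<psi> spider_root"]) (auto simp: positive_eigenfunction_def)
qed (auto intro: positive_eigenfunction_geometric)

section \<open>The maximal entropy random walk\<close>

lemma eigenfunction_power_fst: "positive_eigenfunction G A r (\<lambda>x. g ^ fst x)"
  by (rule positive_eigenfunction_geometric[of 1]) auto

lemma markov_kernel_MERW: "markov_kernel G MERW"
  unfolding MERW_def[abs_def]
  by (rule markov_kernel_of_eigenfunction[OF A_nonneg r_pos eigenfunction_power_fst])

lemma is_MERW_MERW: "is_MERW G A r MERW"
  unfolding is_MERW_def using markov_kernel_MERW eigenfunction_power_fst by (auto simp: MERW_def)

text \<open>The eigenfunction is determined up to a factor, which cancels in
  \<open>\<psi> y / \<psi> x\<close>.\<close>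

lemma is_MERW_unique:
  assumes "is_MERW G A r Q" and x: "x \<in> G" and y: "y \<in> G"
  shows "Q x y = MERW x y"
proof -
  obtain \<psi> where \<psi>: "positive_eigenfunction G A r \<psi>"
    and Q: "Q x y = A x y * (\<psi> y / (r * \<psi> x))"
    using assms by (auto simp: is_MERW_def)
  have eq: "\<psi> z = \<psi> spider_root * g ^ fst z" if "z \<in> G" for z
    using that
  proof (cases rule: spider_cases)
    case (2 n k)
    then show ?thesis
      using positive_eigenfunction_unique[OF \<psi>, of k "Suc n"] by simp
  qed simp
  have "0 < \<psi> spider_root"
    using \<psi> by (simp add: positive_eigenfunction_def)
  then show ?thesis
    unfolding Q MERW_def eq[OF x] eq[OF y] by simp
qed

lemma MERW_pos_up: "k \<in> {1..N} \<Longrightarrow> 0 < MERW (spider_vertex n k) (spider_vertex (Suc n) k)"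
  using r_pos g \<gamma>\<^sub>2 \<gamma>\<^sub>3 by (cases n) (auto simp: MERW_def)

lemma MERW_pos_down: "k \<in> {1..N} \<Longrightarrow> 0 < MERW (spider_vertex (Suc n) k) (spider_vertex n k)"
  using r_pos g \<gamma>\<^sub>3 by (auto simp: MERW_def)

text \<open>Moving edge by edge along a leg, each vertex communicates with the root, and any two
  vertices then communicate through the root.\<close>

lemma MERW_irreducible:
  assumes "x \<in> G" "y \<in> G"
  shows "\<exists>m. 0 < mat_pow G MERW m x y"
proof -
  let ?R = "\<lambda>x y. \<exists>m. 0 < mat_pow G MERW m x y"
  note trans = mat_pow_pos_trans[OF markov_kernel_MERW]
  have step: "?R x y" if "y \<in> G" "0 < MERW x y" for x y
    using mat_pow_1[OF that(1), of MERW x] that(2) by (metis)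
  have refl: "?R x x" for x
    by (rule exI[of _ 0]) simp
  have "?R spider_root (spider_vertex n k) \<and> ?R (spider_vertex n k) spider_root"
    if k: "k \<in> {1..N}" for n k
  proof (induction n)
    case (Suc n)
    have "?R (spider_vertex n k) (spider_vertex (Suc n) k)"
      "?R (spider_vertex (Suc n) k) (spider_vertex n k)"
      by (intro step spider_vertex_in_G k MERW_pos_up MERW_pos_down)+
    then show ?case
      using Suc trans[of spider_root "spider_vertex n k" "spider_vertex (Suc n) k"]
        trans[of "spider_vertex (Suc n) k" "spider_vertex n k" spider_root] k
      by (auto simp del: spider_vertex_Suc)
  qed (simp add: refl)
  note legs = this
  have "?R spider_root z \<and> ?R z spider_root" if "z \<in> G" for z
    using that
  proof (cases rule: spider_cases)
    case (2 n k)
    then show ?thesis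
      using legs[of k "Suc n"] by simp
  qed (simp add: refl)
  then show ?thesis
    using trans[of x spider_root y] assms by auto
qed

section \<open>The invariant probability\<close>

lemma stationary_root: "stationary spider_root = \<gamma>\<^sub>3 * ((1 - g\<^sup>2) / (S * g\<^sup>2 + \<gamma>\<^sub>3 * (1 - g\<^sup>2)))"
  and stationary_leg: "stationary (Suc n, k) =
    \<gamma>\<^sub>2 k * g ^ (2 * Suc n) * ((1 - g\<^sup>2) / (S * g\<^sup>2 + \<gamma>\<^sub>3 * (1 - g\<^sup>2)))"
  by (auto simp: stationary_def)

lemma stationary_pos: "x \<in> G \<Longrightarrow> 0 < stationary x"
  by (erule spider_cases)
    (use g_sq_less_1 denominator_pos \<gamma>\<^sub>2 \<gamma>\<^sub>3 g in \<open>auto simp: stationary_root stationary_leg\<close>)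

lemma has_sum_stationary: "(stationary has_sum 1) G"
proof -
  define D where "D = (1 - g\<^sup>2) / (S * g\<^sup>2 + \<gamma>\<^sub>3 * (1 - g\<^sup>2))"
  have inner: "((\<lambda>k. stationary (n, k)) has_sum (S * D) * (g\<^sup>2) ^ n) {1..N}" if n: "n \<in> {1..}" for n
  proof (rule has_sum_finiteI)
    obtain m where "n = Suc m"
      using n by (cases n) auto
    then have "stationary (n, k) = \<gamma>\<^sub>2 k * (D * (g\<^sup>2) ^ n)" for k
      by (simp only: stationary_leg D_def power_mult) simp
    then show "S * D * (g\<^sup>2) ^ n = (\<Sum>k=1..N. stationary (n, k))"
      by (simp add: S sum_distrib_right mult.assoc)
  qed simp
  \<comment> \<open>The vertices at distance \<open>n\<close> have total mass
    \<open>S * D * (g\<^sup>2) ^ n\<close>. These masses form a geometric series from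
    \<open>n = 1\<close> on; the root is added separately.\<close>
  have outer: "((\<lambda>n. (S * D) * (g\<^sup>2) ^ n) has_sum (S * D) * (g\<^sup>2 / (1 - g\<^sup>2))) {1..}"
    by (intro has_sum_cmult_right has_sum_geometric_from_1) (use g_sq_less_1 in simp)
  have "stationary summable_on {1..} \<times> {1..N}"
    by (rule summable_on_SigmaI[OF inner has_sum_imp_summable[OF outer]])
      (use stationary_pos in \<open>auto simp: G_eq less_imp_le\<close>)
  then have "(stationary has_sum (S * D) * (g\<^sup>2 / (1 - g\<^sup>2))) ({1..} \<times> {1..N})"
    by (intro has_sum_SigmaI[OF _ outer] inner)
  then have "(stationary has_sum stationary spider_root + (S * D) * (g\<^sup>2 / (1 - g\<^sup>2))) G"
    unfolding G_eq by (intro has_sum_insert) (auto simp: spider_root_def)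
  moreover have "stationary spider_root + (S * D) * (g\<^sup>2 / (1 - g\<^sup>2)) = 1"
  proof -
    have "(S * D) * (g\<^sup>2 / (1 - g\<^sup>2)) = S * g\<^sup>2 / (S * g\<^sup>2 + \<gamma>\<^sub>3 * (1 - g\<^sup>2))"
      using g_sq_less_1 by (simp add: D_def)
    then show ?thesis
      using denominator_pos by (simp add: stationary_root add_divide_distrib[symmetric] add.commute)
  qed
  ultimately show ?thesis
    by simp
qed

text \<open>Undoing the conjugation: invariance of \<open>\<pi>\<close> means that
  \<open>\<pi> x / g ^ fst x\<close> is a left eigenvector of \<open>A\<close> for \<open>r\<close>,
  to which the column sums apply.\<close>

lemma has_sum_MERW_iff:
  assumes "y \<in> G"
  shows "((\<lambda>x. \<pi> x * MERW x y) has_sum \<pi> y) G \<longleftrightarrow>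
    ((\<lambda>x. \<pi> x / g ^ fst x * A x y) has_sum r * (\<pi> y / g ^ fst y)) G"
proof -
  have scale: "(f has_sum s) G \<longleftrightarrow> ((\<lambda>x. c * f x) has_sum c * s) G"
    if "c \<noteq> 0" for c s :: real and f :: "nat \<times> nat \<Rightarrow> real"
    by (subst has_sum_cmult_right_iff[OF that]) (simp add: that)
  have "((\<lambda>x. \<pi> x / g ^ fst x * A x y) has_sum r * (\<pi> y / g ^ fst y)) G \<longleftrightarrow>
    ((\<lambda>x. g ^ fst y / r * (\<pi> x / g ^ fst x * A x y)) has_sum g ^ fst y / r * (r * (\<pi> y / g ^ fst y))) G"
    by (rule scale) (use g r_pos in simp)
  also have "g ^ fst y / r * (r * (\<pi> y / g ^ fst y)) = \<pi> y"
    using g r_pos by simp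
  also have "(\<lambda>x. g ^ fst y / r * (\<pi> x / g ^ fst x * A x y)) = (\<lambda>x. \<pi> x * MERW x y)"
    by (simp add: MERW_def fun_eq_iff)
  finally show ?thesis ..
qed

lemma invariant_probability_stationary: "invariant_probability G MERW stationary"
  unfolding invariant_probability_def
proof (intro conjI ballI)
  define D where "D = (1 - g\<^sup>2) / (S * g\<^sup>2 + \<gamma>\<^sub>3 * (1 - g\<^sup>2))"
  define f where "f x = stationary x / g ^ fst x" for x
  have f_root: "f spider_root = D * \<gamma>\<^sub>3"
    by (simp add: f_def stationary_root D_def)
  have f_leg: "f (Suc n, k) = D * \<gamma>\<^sub>2 k * g ^ Suc n" for n k
    using g unfolding f_def stationary_leg D_def[symmetric] by (simp add: mult_2 power_add)
  fix y assume y: "y \<in> G"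
  have "((\<lambda>x. f x * A x y) has_sum r * f y) G"
    using y
  proof (cases rule: spider_cases)
    case 1
    have "(\<Sum>k=1..N. f (Suc 0, k)) = D * S * g"
      by (simp add: f_leg S sum_distrib_left sum_distrib_right)
    then have "\<gamma>\<^sub>1 * f spider_root + \<gamma>\<^sub>3 * (\<Sum>k=1..N. f (Suc 0, k)) = r * f y"
      using 1 by (simp add: f_root r algebra_simps)
    then show ?thesis
      using has_sum_A_col_root[of f] 1 by simp
  next
    case (2 n k)
    \<comment> \<open>For \<open>n = 0\<close> the term from the root is
      \<open>\<gamma>\<^sub>2 k * (D * \<gamma>\<^sub>3)\<close>, which is
      \<open>\<gamma>\<^sub>3\<close> times the leg formula continued to exponent 0. Both cases thus
      reduce to \<open>balance\<close>.\<close>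
    have "(if n = 0 then \<gamma>\<^sub>2 k else \<gamma>\<^sub>3) * f (spider_vertex n k) + \<gamma>\<^sub>3 * f (Suc (Suc n), k) = r * f y"
      using 2 g by (cases n) (auto simp: f_root f_leg balance field_simps)
    then show ?thesis
      using has_sum_A_col_leg[OF 2(1), of f n] 2 by simp
  qed
  then show "((\<lambda>x. stationary x * MERW x y) has_sum stationary y) G"
    unfolding has_sum_MERW_iff[OF y] f_def .
qed (use stationary_pos has_sum_stationary in \<open>auto simp: less_imp_le\<close>)

text \<open>The left eigenvector solves the leg recurrence. Its component along
  \<open>(1 / g) ^ n\<close> would contribute a constant to \<open>\<pi>\<close>, as
  \<open>\<pi>\<close> carries another factor \<open>g ^ n\<close>, and summability rules this
  out.\<close>

lemma invariant_probability_leg: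
  assumes \<pi>: "invariant_probability G MERW \<pi>" and k: "k \<in> {1..N}"
  shows "\<pi> (Suc n, k) = \<pi> spider_root * (\<gamma>\<^sub>2 k / \<gamma>\<^sub>3) * g ^ (2 * Suc n)"
proof -
  define f where "f x = \<pi> x / g ^ fst x" for x
  \<comment> \<open>The value at 0 is rescaled by
    \<open>\<gamma>\<^sub>2 k / \<gamma>\<^sub>3\<close> so that the recurrence also holds at the
    first vertex, where the weight of the incoming edge differs.\<close>
  define u where "u n = (if n = 0 then \<gamma>\<^sub>2 k / \<gamma>\<^sub>3 * f spider_root else f (n, k))" for n
  have inv: "((\<lambda>x. f x * A x y) has_sum r * f y) G" if "y \<in> G" for y
    using \<pi> that has_sum_MERW_iff[OF that, of \<pi>] by (simp add: invariant_probability_def f_def)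
  have rec: "u n + u (Suc (Suc n)) = (g + 1 / g) * u (Suc n)" for n
  proof -
    have "(if n = 0 then \<gamma>\<^sub>2 k else \<gamma>\<^sub>3) * f (spider_vertex n k) = \<gamma>\<^sub>3 * u n"
      using \<gamma>\<^sub>3 by (cases n) (auto simp: u_def)
    then have "\<gamma>\<^sub>3 * u n + \<gamma>\<^sub>3 * u (Suc (Suc n)) = \<gamma>\<^sub>3 * ((g + 1 / g) * u (Suc n))"
      using has_sum_unique[OF has_sum_A_col_leg[OF k, of f n] inv] k by (simp add: u_def balance)
    then show ?thesis
      using \<gamma>\<^sub>3 by (simp flip: distrib_left)
  qed
  have g0: "g \<noteq> 0"
    using g by simp
  have \<pi>_u: "\<pi> (Suc n, k) = u (Suc n) * g ^ Suc n" for n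
    using g by (simp add: u_def f_def)
  have "\<pi> summable_on (\<lambda>n. (Suc n, k)) ` UNIV"
    by (rule summable_on_subset_banach[of _ G])
      (use \<pi> k in \<open>auto simp: invariant_probability_def has_sum_imp_summable\<close>)
  then have "summable (\<lambda>n. \<pi> (Suc n, k))"
    by (subst (asm) summable_on_reindex) (auto simp: inj_on_def o_def summable_on_imp_summable)
  then have lim: "(\<lambda>n. \<pi> (Suc n, k)) \<longlonglongrightarrow> 0"
    by (rule summable_LIMSEQ_zero)
  \<comment> \<open>The defect of \<open>u\<close> grows exactly like \<open>(1 / g) ^ n\<close>, so
    in terms of \<open>\<pi>\<close> it is constant. The left side tends to 0, which forces the
    defect to vanish.\<close>
  have "\<pi> (Suc (Suc n), k) - g\<^sup>2 * \<pi> (Suc n, k) = g * (u 1 - g * u 0)" for n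
  proof -
    have "\<pi> (Suc (Suc n), k) - g\<^sup>2 * \<pi> (Suc n, k) = (u (Suc (Suc n)) - g * u (Suc n)) * g ^ Suc (Suc n)"
      by (simp add: \<pi>_u power2_eq_square algebra_simps)
    also have "\<dots> = g * (u 1 - g * u 0)"
      unfolding linear_recurrence_defect[where u = u, OF g0 rec] using g by simp
    finally show ?thesis .
  qed
  moreover have "(\<lambda>n. \<pi> (Suc (Suc n), k) - g\<^sup>2 * \<pi> (Suc n, k)) \<longlonglongrightarrow> 0 - g\<^sup>2 * 0"
    by (intro tendsto_intros lim LIMSEQ_Suc[OF lim])
  ultimately have "g * (u 1 - g * u 0) = 0"
    by (simp add: LIMSEQ_const_iff)
  then have "u (Suc n) = u 0 * g ^ Suc n"
    using g0 by (intro linear_recurrence_geometric[where u = u, OF g0 rec]) simp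
  then show ?thesis
    unfolding \<pi>_u by (simp add: u_def f_def mult_2 power_add)
qed

text \<open>The value at the root determines all values on the legs, and the total mass 1 fixes the
  remaining scalar.\<close>

lemma invariant_probability_unique:
  assumes \<pi>: "invariant_probability G MERW \<pi>" and "x \<in> G"
  shows "\<pi> x = stationary x"
proof -
  define c where "c = \<pi> spider_root / stationary spider_root"
  have root: "\<pi> spider_root = c * stationary spider_root"
    using stationary_pos[of spider_root] by (simp add: c_def)
  have eq: "\<pi> y = c * stationary y" if "y \<in> G" for y
    using that
  proof (cases rule: spider_cases)
    case (2 n k)
    then show ?thesis
      using invariant_probability_leg[OF \<pi> 2(1), of n] \<gamma>\<^sub>3
      by (simp add: root stationary_root stationary_leg)
  qed (simp add: root)
  have "(\<pi> has_sum c * 1) G"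
    using has_sum_cmult_right[OF has_sum_stationary, of c]
    by (rule has_sum_cong[THEN iffD2, rotated]) (rule eq)
  moreover have "(\<pi> has_sum 1) G"
    using \<pi> by (simp add: invariant_probability_def)
  ultimately have "c * 1 = 1"
    by (rule has_sum_unique)
  then show ?thesis
    using eq[OF assms(2)] by simp
qed

lemma invariant_probability_iff:
  "invariant_probability G MERW \<pi> \<longleftrightarrow> (\<forall>x\<in>G. \<pi> x = stationary x)"
proof
  assume eq: "\<forall>x\<in>G. \<pi> x = stationary x"
  have "invariant_probability G MERW \<pi> \<longleftrightarrow> invariant_probability G MERW stationary"
    unfolding invariant_probability_def using eq
    by (intro conj_cong ball_cong has_sum_cong refl) (auto intro!: has_sum_cong)
  then show "invariant_probability G MERW \<pi>"
    using invariant_probability_stationary by simp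
qed (use invariant_probability_unique in blast)

section \<open>The spectral radius of the spider and its decay rate\<close>

lemma comb_spectral_radius_spider:
  assumes "x \<in> G" "y \<in> G"
  shows "comb_spectral_radius G A x y = r"
  by (rule comb_spectral_radius_eqI[OF markov_kernel_MERW invariant_probability_stationary
        MERW_irreducible r_pos _ _ assms stationary_pos[OF assms(2)], where \<psi> = "\<lambda>x. g ^ fst x"])
    (use g in \<open>auto simp: MERW_def\<close>)

end

text \<open>Multiplied by \<open>g\<close>, the equation says that the polynomial \<open>f\<close>
  vanishes at \<open>g\<close>. It equals \<open>- c\<close> at 0 and \<open>a + S - 2 * c\<close>
  at 1, so the intermediate value theorem gives a zero strictly between.\<close>

lemma supercritical_decay_rate:
  fixes a S c :: real
  assumes "0 < c" and "2 * c - a - S < 0"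
  shows "\<exists>g. 0 < g \<and> g < 1 \<and> a + S * g = c * (g + 1 / g)"
proof -
  define f where "f t = (S - c) * t\<^sup>2 + a * t - c" for t
  have "continuous_on {0..1} f"
    unfolding f_def by (intro continuous_intros)
  moreover have "f 0 < 0" "0 < f 1"
    using assms by (auto simp: f_def)
  ultimately obtain g where g: "0 \<le> g" "g \<le> 1" "f g = 0"
    using IVT'[of f 0 0 1] by auto
  moreover have "g \<noteq> 0" "g \<noteq> 1"
    using g(3) \<open>f 0 < 0\<close> \<open>0 < f 1\<close> by auto
  ultimately show ?thesis
    by (intro exI[of _ g]) (auto simp: f_def field_simps power2_eq_square)
qed

text \<open>The equivalences for eigenfunctions and invariant probabilities contain existence and
  uniqueness at once. The spectral radius is taken at arbitrary vertices, which expresses its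
  independence of the base points.\<close>

theorem proposition3p3:
  fixes N :: nat
    and \<gamma>\<^sub>1 :: real and \<gamma>\<^sub>2 :: "nat \<Rightarrow> real" and \<gamma>\<^sub>3 :: real
    and S\<^sub>2 \<rho> \<Gamma> :: real
    and G :: "(nat \<times> nat) set" and A :: "nat \<times> nat \<Rightarrow> nat \<times> nat \<Rightarrow> real"
    and x\<^sub>0 y\<^sub>0 :: "nat \<times> nat"
  assumes N: "1 \<le> N"
    and \<gamma>1: "0 \<le> \<gamma>\<^sub>1"
    and \<gamma>2: "\<forall>k\<in>{1..N}. 0 < \<gamma>\<^sub>2 k"
    and \<gamma>3: "0 < \<gamma>\<^sub>3"
    and S2: "S\<^sub>2 = (\<Sum>k=1..N. \<gamma>\<^sub>2 k)"
    and Lambda: "2 * \<gamma>\<^sub>3 - \<gamma>\<^sub>1 - S\<^sub>2 < 0"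
    and G: "G = spider N"
    and A: "A = spider_adj \<gamma>\<^sub>1 \<gamma>\<^sub>2 \<gamma>\<^sub>3"
    and base_points: "x\<^sub>0 \<in> G" "y\<^sub>0 \<in> G"
    and rho: "\<rho> = comb_spectral_radius G A x\<^sub>0 y\<^sub>0"
    and Gamma: "\<Gamma> = (\<rho> - \<gamma>\<^sub>1) / S\<^sub>2"
  shows "(\<forall>\<psi>. positive_eigenfunction G A \<rho> \<psi> \<longleftrightarrow>
            (\<exists>c>0. \<forall>n. \<forall>k\<in>{1..N}. \<psi> (spider_vertex n k) = c * \<Gamma> ^ n)) \<and>
         (\<exists>P. is_MERW G A \<rho> P \<and>
            (\<forall>Q. is_MERW G A \<rho> Q \<longrightarrow> (\<forall>x\<in>G. \<forall>y\<in>G. Q x y = P x y)) \<and>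
            (\<forall>k\<in>{1..N}. \<forall>n\<ge>1.
               P (spider_vertex n k) (spider_vertex (n + 1) k) = \<gamma>\<^sub>3 / \<rho> * \<Gamma> \<and>
               P (spider_vertex n k) (spider_vertex (n - 1) k) = \<gamma>\<^sub>3 / \<rho> * inverse \<Gamma>) \<and>
            (\<forall>k\<in>{1..N}. P spider_root (spider_vertex 1 k) = \<gamma>\<^sub>2 k * \<Gamma> / \<rho>) \<and>
            P spider_root spider_root = \<gamma>\<^sub>1 / \<rho> \<and>
            positive_recurrent G P \<and>
            (\<forall>\<pi>. invariant_probability G P \<pi> \<longleftrightarrow>
               (\<forall>n\<ge>1. \<forall>k\<in>{1..N}. \<pi> (spider_vertex n k) =
                  \<gamma>\<^sub>2 k * (1 - \<Gamma>\<^sup>2) * \<Gamma> ^ (2 * n) / (S\<^sub>2 * \<Gamma>\<^sup>2 + \<gamma>\<^sub>3 * (1 - \<Gamma>\<^sup>2))) \<and>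
               \<pi> spider_root = \<gamma>\<^sub>3 * (1 - \<Gamma>\<^sup>2) / (S\<^sub>2 * \<Gamma>\<^sup>2 + \<gamma>\<^sub>3 * (1 - \<Gamma>\<^sup>2))))"
proof -
  obtain g where g: "0 < g" "g < 1" and balance: "\<gamma>\<^sub>1 + S\<^sub>2 * g = \<gamma>\<^sub>3 * (g + 1 / g)"
    using supercritical_decay_rate[OF \<gamma>3 Lambda] by blast
  interpret supercritical_spider N \<gamma>\<^sub>1 \<gamma>\<^sub>2 \<gamma>\<^sub>3 S\<^sub>2 g "\<gamma>\<^sub>1 + S\<^sub>2 * g"
    using N \<gamma>1 \<gamma>2 \<gamma>3 S2 g balance by unfold_locales auto
  \<comment> \<open>The spectral radius is the eigenvalue belonging to \<open>g\<close>; the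
    definition of \<open>\<Gamma>\<close> then gives back \<open>g\<close>.\<close>
  have rho': "\<rho> = \<gamma>\<^sub>1 + S\<^sub>2 * g"
    using comb_spectral_radius_spider base_points by (simp add: rho G A)
  have Gamma': "\<Gamma> = g"
    using S_pos by (simp add: Gamma rho')
  have up_down: "MERW (spider_vertex n k) (spider_vertex (n + 1) k) = \<gamma>\<^sub>3 / \<rho> * \<Gamma> \<and>
      MERW (spider_vertex n k) (spider_vertex (n - 1) k) = \<gamma>\<^sub>3 / \<rho> * inverse \<Gamma>" if "n \<ge> 1" for n k
    using that g by (cases n) (auto simp: MERW_def Gamma' rho' inverse_eq_divide)
  have root: "MERW spider_root (spider_vertex 1 k) = \<gamma>\<^sub>2 k * \<Gamma> / \<rho>"
    "MERW spider_root spider_root = \<gamma>\<^sub>1 / \<rho>" for k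
    by (auto simp: MERW_def Gamma' rho')
  have leg: "stationary (spider_vertex n k) =
      \<gamma>\<^sub>2 k * (1 - \<Gamma>\<^sup>2) * \<Gamma> ^ (2 * n) / (S\<^sub>2 * \<Gamma>\<^sup>2 + \<gamma>\<^sub>3 * (1 - \<Gamma>\<^sup>2))" if "n \<ge> 1" for n k
    using that by (cases n) (auto simp: stationary_leg Gamma')
  have "invariant_probability G MERW \<pi> \<longleftrightarrow>
      (\<forall>n\<ge>1. \<forall>k\<in>{1..N}. \<pi> (spider_vertex n k) = stationary (spider_vertex n k)) \<and>
      \<pi> spider_root = stationary spider_root" for \<pi>
    unfolding G invariant_probability_iff by (auto simp: G_eq spider_vertex_def)
  then have invariant: "invariant_probability G MERW \<pi> \<longleftrightarrow>
      (\<forall>n\<ge>1. \<forall>k\<in>{1..N}. \<pi> (spider_vertex n k) =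
         \<gamma>\<^sub>2 k * (1 - \<Gamma>\<^sup>2) * \<Gamma> ^ (2 * n) / (S\<^sub>2 * \<Gamma>\<^sup>2 + \<gamma>\<^sub>3 * (1 - \<Gamma>\<^sup>2))) \<and>
      \<pi> spider_root = \<gamma>\<^sub>3 * (1 - \<Gamma>\<^sup>2) / (S\<^sub>2 * \<Gamma>\<^sup>2 + \<gamma>\<^sub>3 * (1 - \<Gamma>\<^sup>2))" for \<pi>
    by (simp add: leg stationary_root Gamma')
  have recurrent: "positive_recurrent G MERW"
    unfolding G
    by (rule positive_recurrent_if_invariant[OF markov_kernel_MERW invariant_probability_stationary
          stationary_pos])
  have eigenfunctions: "positive_eigenfunction G A \<rho> \<psi> \<longleftrightarrow>
      (\<exists>c>0. \<forall>n. \<forall>k\<in>{1..N}. \<psi> (spider_vertex n k) = c * \<Gamma> ^ n)" for \<psi>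
    using positive_eigenfunction_iff by (simp add: G A rho' Gamma')
  have "is_MERW G A \<rho> MERW" "\<forall>Q. is_MERW G A \<rho> Q \<longrightarrow> (\<forall>x\<in>G. \<forall>y\<in>G. Q x y = MERW x y)"
    using is_MERW_MERW is_MERW_unique by (auto simp: G A rho')
  with eigenfunctions up_down root recurrent invariant show ?thesis
    by (intro conjI allI exI[of _ MERW]) auto
qed

end
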